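(* Let $r,d,q$ be positive integers. Every sequence of $n\ge(\lceil q/r\rceil+2)(2rd+1)^d$ elements of $[-r,r]^d$ whose sum lies in $[-q,q]^d$ contains a nonempty proper subsequence whose sum is the zero vector.
   Context: $[-r,r]^d$ denotes the set of $d$-dimensional integer vectors all of whose coordinates lie in $\{-r,\ldots,r\}$; similarly $[-q,q]^d$. A subsequence is a sub-multiset of the terms (indexed by a subset of positions); proper means not all terms. *)

theory Defs
  imports "HOL-Analysis.Analysis"
begin

definition int_box :: "nat \<Rightarrow> (int ^ 'd) set" where
  "int_box r = {v. \<forall>i. v $ i \<in> {- int r..int r}}"

end

theory Submission
  imports Defs
begin

text \<open>
  Write the negated sum of the sequence as a sum of $m$ auxiliary vectors of the box
  $[-r,r]^d$ and append them, so that the total becomes zero. By the Steinitz lemma (with the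
  constant $d$ of Grinberg and Sevastyanov) the terms can be ordered so that all partial sums
  lie in $[-rd,rd]^d$. This order is built from the back: while the set $A$ of remaining terms
  carries weights in $[0,1]$ with vanishing weighted sum and total at least $|A|-d$, scaling the
  total down to $|A|-d-1$ and moving to weights with at most $d+1$ fractional values produces a
  zero weight, whose term is put last. By the pigeonhole principle two partial sums agree and
  involve the same number of auxiliary vectors; the block between them consists of original
  terms and sums to zero. The block is proper when the total sum is nonzero, where
  $m = \lceil q/r \rceil$ works; when it is zero one drops a term and takes $m = 1$.
\<close>

section \<open>Fractional zero-sum subfamilies\<close>

lemma affinely_dependent_family:
  fixes v :: "'b \<Rightarrow> 'a::euclidean_space"
  assumes "finite F" and "DIM('a) + 2 \<le> card F"
  obtains \<mu> :: "'b \<Rightarrow> real"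
  where "\<exists>i\<in>F. \<mu> i \<noteq> 0" and "sum \<mu> F = 0" and "(\<Sum>i\<in>F. \<mu> i *\<^sub>R v i) = 0"
proof (cases "inj_on v F")
  case True
  then have "affine_dependent (v ` F)"
    using assms by (intro affine_dependent_biggerset) (auto simp: card_image)
  then obtain U where "sum U (v ` F) = 0" "\<exists>w\<in>v ` F. U w \<noteq> 0"
      "(\<Sum>w\<in>v ` F. U w *\<^sub>R w) = 0"
    using assms(1) by (auto simp: affine_dependent_explicit_finite)
  then show ?thesis
    using True by (intro that[of "\<lambda>i. U (v i)"]) (auto simp: sum.reindex)
next
  case False
  then obtain i j where ij: "i \<in> F" "j \<in> F" "i \<noteq> j" "v i = v j"
    by (auto simp: inj_on_def)
  define \<mu> :: "'b \<Rightarrow> real" where "\<mu> k = (if k = i then 1 else 0) - (if k = j then 1 else 0)" for k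
  have "sum \<mu> F = 0"
    using ij assms(1) by (simp add: \<mu>_def sum_subtractf)
  moreover have "(\<Sum>k\<in>F. \<mu> k *\<^sub>R v k) = 0"
    using ij assms(1)
    by (simp add: \<mu>_def scaleR_left_diff_distrib sum_subtractf if_distrib[of "\<lambda>c. c *\<^sub>R _"]
        cong: if_cong)
  ultimately show ?thesis
    using ij by (intro that[of \<mu>]) (auto simp: \<mu>_def)
qed

lemma line_meets_unit_cube_boundary:
  fixes \<alpha> \<mu> :: "'b \<Rightarrow> 'a::linordered_field"
  assumes "finite A" and cube: "\<And>i. i \<in> A \<Longrightarrow> \<alpha> i \<in> {0..1}"
    and interior: "\<And>i. i \<in> A \<Longrightarrow> \<mu> i \<noteq> 0 \<Longrightarrow> \<alpha> i \<in> {0<..<1}" and "\<exists>i\<in>A. \<mu> i \<noteq> 0"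
  obtains t j where "\<And>i. i \<in> A \<Longrightarrow> \<alpha> i + t * \<mu> i \<in> {0..1}"
    and "j \<in> A" and "\<mu> j \<noteq> 0" and "\<alpha> j + t * \<mu> j \<in> {0, 1}"
proof -
  define exit_time where "exit_time i = (of_bool (\<mu> i > 0) - \<alpha> i) / \<mu> i" for i
  define S where "S = {i\<in>A. \<mu> i \<noteq> 0}"
  have "finite S" "S \<noteq> {}"
    using assms(1,4) by (auto simp: S_def)
  then obtain j where j: "j \<in> S" and earliest: "\<And>i. i \<in> S \<Longrightarrow> exit_time j \<le> exit_time i"
    using ex_is_arg_min_if_finite[of S exit_time] by (auto simp: is_arg_min_linorder)
  define t where "t = exit_time j"
  have "t \<ge> 0"
    using j interior[of j] by (auto simp: t_def exit_time_def S_def divide_nonneg_neg)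
  have "\<alpha> i + t * \<mu> i \<in> {0..1}" if i: "i \<in> A" for i
  proof -
    have t_le: "t \<le> exit_time i" if "\<mu> i \<noteq> 0"
      using earliest[of i] i that by (simp add: t_def S_def)
    consider (zero) "\<mu> i = 0" | (pos) "\<mu> i > 0" | (neg) "\<mu> i < 0" by fastforce
    then show ?thesis
    proof cases
      case zero
      then show ?thesis using cube[OF i] by simp
    next
      case pos
      then have "t * \<mu> i \<le> 1 - \<alpha> i" "0 \<le> t * \<mu> i"
        using t_le \<open>t \<ge> 0\<close> by (simp_all add: exit_time_def pos_le_divide_eq)
      then show ?thesis using cube[OF i] by auto
    next
      case neg
      then have "- \<alpha> i \<le> t * \<mu> i" "t * \<mu> i \<le> 0"
        using t_le \<open>t \<ge> 0\<close>
        by (simp_all add: exit_time_def neg_le_minus_divide_eq mult_nonneg_nonpos)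
      then show ?thesis using cube[OF i] by auto
    qed
  qed
  moreover have "\<alpha> j + t * \<mu> j \<in> {0, 1}"
    using j by (simp add: t_def exit_time_def S_def)
  ultimately show ?thesis
    using j by (intro that[of t j]) (auto simp: S_def)
qed

definition fractional_zero_sum :: "('b \<Rightarrow> 'a::real_vector) \<Rightarrow> 'b set \<Rightarrow> ('b \<Rightarrow> real) \<Rightarrow> bool" where
  "fractional_zero_sum v A \<alpha> \<longleftrightarrow> (\<forall>i\<in>A. \<alpha> i \<in> {0..1}) \<and> (\<Sum>i\<in>A. \<alpha> i *\<^sub>R v i) = 0"

definition fractional_part :: "'b set \<Rightarrow> ('b \<Rightarrow> real) \<Rightarrow> 'b set" where
  "fractional_part A \<alpha> = {i\<in>A. \<alpha> i \<in> {0<..<1}}"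

lemma fractional_zero_sum_scale:
  assumes "fractional_zero_sum v A \<alpha>" and "c \<in> {0..1}"
  shows "fractional_zero_sum v A (\<lambda>i. c * \<alpha> i)"
proof -
  have "(\<Sum>i\<in>A. (c * \<alpha> i) *\<^sub>R v i) = c *\<^sub>R (\<Sum>i\<in>A. \<alpha> i *\<^sub>R v i)"
    by (simp add: scaleR_sum_right)
  then show ?thesis
    using assms by (auto simp: fractional_zero_sum_def mult_le_one)
qed

lemma exists_smaller_fractional_part:
  fixes v :: "'b \<Rightarrow> 'a::euclidean_space"
  assumes A: "finite A" and \<alpha>: "fractional_zero_sum v A \<alpha>"
    and "DIM('a) + 2 \<le> card (fractional_part A \<alpha>)"
  obtains \<beta> where "fractional_zero_sum v A \<beta>" and "sum \<beta> A = sum \<alpha> A"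
    and "card (fractional_part A \<beta>) < card (fractional_part A \<alpha>)"
proof -
  define F where "F = fractional_part A \<alpha>"
  have F: "finite F" "F \<subseteq> A"
    using A by (auto simp: F_def fractional_part_def)
  obtain \<nu> where \<nu>: "\<exists>i\<in>F. \<nu> i \<noteq> 0" "sum \<nu> F = 0" "(\<Sum>i\<in>F. \<nu> i *\<^sub>R v i) = 0"
    using affinely_dependent_family[of F v] F(1) assms(3) by (auto simp: F_def)
  define \<mu> where "\<mu> i = (if i \<in> F then \<nu> i else 0)" for i
  have \<mu>_sum: "sum \<mu> A = 0" and \<mu>_combination: "(\<Sum>i\<in>A. \<mu> i *\<^sub>R v i) = 0"
    using \<nu> A F by (simp_all add: \<mu>_def if_distrib[of "\<lambda>c. c *\<^sub>R _"] sum.If_cases Int_absorb1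
        cong: if_cong)
  have "\<alpha> i \<in> {0..1}" if "i \<in> A" for i
    using \<alpha> that by (simp add: fractional_zero_sum_def)
  moreover have "\<alpha> i \<in> {0<..<1}" if "\<mu> i \<noteq> 0" for i
    using that by (auto simp: \<mu>_def F_def fractional_part_def split: if_splits)
  moreover have "\<exists>i\<in>A. \<mu> i \<noteq> 0"
    using \<nu>(1) F by (auto simp: \<mu>_def)
  ultimately obtain t j where cube: "\<And>i. i \<in> A \<Longrightarrow> \<alpha> i + t * \<mu> i \<in> {0..1}"
    and j: "\<mu> j \<noteq> 0" "\<alpha> j + t * \<mu> j \<in> {0, 1}"
    using line_meets_unit_cube_boundary[OF A, of \<alpha> \<mu>] by metis
  define \<beta> where "\<beta> i = \<alpha> i + t * \<mu> i" for i
  have "(\<Sum>i\<in>A. \<beta> i *\<^sub>R v i) = (\<Sum>i\<in>A. \<alpha> i *\<^sub>R v i) + t *\<^sub>R (\<Sum>i\<in>A. \<mu> i *\<^sub>R v i)"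
    by (simp add: \<beta>_def scaleR_left_distrib sum.distrib scaleR_sum_right)
  then have "fractional_zero_sum v A \<beta>"
    using cube \<alpha> \<mu>_combination by (simp add: fractional_zero_sum_def \<beta>_def)
  moreover have "sum \<beta> A = sum \<alpha> A"
    using \<mu>_sum by (simp add: \<beta>_def sum.distrib flip: sum_distrib_left)
  moreover have "fractional_part A \<beta> \<subseteq> F - {j}"
    using j by (auto simp: \<beta>_def \<mu>_def F_def fractional_part_def split: if_splits)
  then have "fractional_part A \<beta> \<subset> F"
    using j(1) by (auto simp: \<mu>_def split: if_splits)
  then have "card (fractional_part A \<beta>) < card (fractional_part A \<alpha>)"
    using F(1) unfolding F_def by (rule psubset_card_mono[rotated])
  ultimately show ?thesis by (rule that)
qed

lemma exists_small_fractional_part: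
  fixes v :: "'b \<Rightarrow> 'a::euclidean_space"
  assumes "finite A" and "fractional_zero_sum v A \<alpha>"
  obtains \<beta> where "fractional_zero_sum v A \<beta>" and "sum \<beta> A = sum \<alpha> A"
    and "card (fractional_part A \<beta>) \<le> DIM('a) + 1"
proof -
  obtain \<beta> where \<beta>: "fractional_zero_sum v A \<beta>" "sum \<beta> A = sum \<alpha> A"
    and minimal: "\<And>\<gamma>. fractional_zero_sum v A \<gamma> \<Longrightarrow> sum \<gamma> A = sum \<alpha> A \<Longrightarrow>
      card (fractional_part A \<beta>) \<le> card (fractional_part A \<gamma>)"
    using ex_has_least_nat[of "\<lambda>\<beta>. fractional_zero_sum v A \<beta> \<and> sum \<beta> A = sum \<alpha> A" \<alpha>
        "\<lambda>\<beta>. card (fractional_part A \<beta>)"] assms(2) by blast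
  have "\<not> DIM('a) + 2 \<le> card (fractional_part A \<beta>)"
    using exists_smaller_fractional_part[OF assms(1) \<beta>(1)] \<beta>(2) minimal by (metis not_le)
  then show ?thesis
    using \<beta> that by simp
qed

lemma exists_zero_weight:
  fixes \<beta> :: "'b \<Rightarrow> real"
  assumes A: "finite A" and cube: "\<And>i. i \<in> A \<Longrightarrow> \<beta> i \<in> {0..1}"
    and "sum \<beta> A < card A" and few: "sum \<beta> A + card (fractional_part A \<beta>) \<le> card A"
  shows "\<exists>a\<in>A. \<beta> a = 0"
proof (rule ccontr)
  let ?F = "fractional_part A \<beta>"
  assume no_zero: "\<not> (\<exists>a\<in>A. \<beta> a = 0)"
  have pos: "\<beta> i > 0" if "i \<in> A" for i
    using no_zero cube[OF that] that by force
  then have one: "\<beta> i = 1" if "i \<in> A - ?F" for i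
    using cube that by (force simp: fractional_part_def)
  have F: "finite ?F" "?F \<subseteq> A"
    using A by (auto simp: fractional_part_def)
  then have total: "sum \<beta> A = card A - card ?F + sum \<beta> ?F"
    using A one by (simp add: sum.subset_diff[of ?F A] card_Diff_subset of_nat_diff card_mono)
  then have "?F \<noteq> {}"
    using assms(3) by auto
  then have "sum \<beta> ?F > 0"
    using F pos by (intro sum_pos) auto
  then show False
    using few total F A by (simp add: of_nat_diff card_mono)
qed

section \<open>The Steinitz lemma\<close>

definition steinitz_set :: "('b \<Rightarrow> 'a::euclidean_space) \<Rightarrow> 'b set \<Rightarrow> bool" where
  "steinitz_set v A \<longleftrightarrow> (\<exists>\<alpha>. fractional_zero_sum v A \<alpha> \<and> real (card A) \<le> sum \<alpha> A + DIM('a))"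

lemma steinitz_set_if_card_le_DIM:
  fixes v :: "'b \<Rightarrow> 'a::euclidean_space"
  assumes "card A \<le> DIM('a)"
  shows "steinitz_set v A"
  unfolding steinitz_set_def
  using assms by (intro exI[of _ "\<lambda>_. 0"]) (simp add: fractional_zero_sum_def)

lemma steinitz_set_if_sum_eq_0:
  assumes "sum v A = 0"
  shows "steinitz_set v A"
  unfolding steinitz_set_def
  using assms by (intro exI[of _ "\<lambda>_. 1"]) (simp add: fractional_zero_sum_def)

lemma steinitz_set_remove:
  fixes v :: "'b \<Rightarrow> 'a::euclidean_space"
  assumes A: "finite A" "A \<noteq> {}" and "steinitz_set v A"
  obtains a where "a \<in> A" and "steinitz_set v (A - {a})"
proof (cases "card A \<le> DIM('a) + 1")
  case True
  from A obtain a where "a \<in> A" by blast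
  with True A show ?thesis
    by (intro that[of a] steinitz_set_if_card_le_DIM) auto
next
  case False
  define s where "s = real (card A) - 1 - DIM('a)"
  have "s > 0" using False by (simp add: s_def)
  obtain \<alpha> where \<alpha>: "fractional_zero_sum v A \<alpha>" "s < sum \<alpha> A"
    using assms(3) by (auto simp: steinitz_set_def s_def)
  define \<kappa> where "\<kappa> i = s / sum \<alpha> A * \<alpha> i" for i
  have "fractional_zero_sum v A \<kappa>"
    unfolding \<kappa>_def using \<open>s > 0\<close> \<alpha> by (intro fractional_zero_sum_scale) simp_all
  moreover have "sum \<kappa> A = s"
    using \<open>s > 0\<close> \<alpha>(2) by (simp add: \<kappa>_def flip: sum_divide_distrib sum_distrib_left)
  ultimately obtain \<beta> where \<beta>: "fractional_zero_sum v A \<beta>" "sum \<beta> A = s"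
    and few: "card (fractional_part A \<beta>) \<le> DIM('a) + 1"
    using exists_small_fractional_part[OF A(1), of v \<kappa>] by metis
  have "\<exists>a\<in>A. \<beta> a = 0"
  proof (rule exists_zero_weight[OF A(1)])
    show "\<beta> i \<in> {0..1}" if "i \<in> A" for i
      using \<beta>(1) that by (simp add: fractional_zero_sum_def)
    show "sum \<beta> A < card A" "sum \<beta> A + card (fractional_part A \<beta>) \<le> card A"
      using \<beta>(2) few by (simp_all add: s_def)
  qed
  then obtain a where a: "a \<in> A" "\<beta> a = 0" by blast
  have "fractional_zero_sum v (A - {a}) \<beta>"
    using \<beta>(1) a A(1) by (simp add: fractional_zero_sum_def sum_diff1)
  moreover have "card (A - {a}) \<le> sum \<beta> (A - {a}) + DIM('a)"
    using \<beta>(2) a A False by (simp add: sum_diff1 s_def of_nat_diff)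
  ultimately show ?thesis
    using that[OF a(1)] by (auto simp: steinitz_set_def)
qed

lemma convex_sum_le_1:
  fixes B :: "'a::real_vector set"
  assumes "finite A" and "convex B" and "0 \<in> B" and v: "\<And>i. i \<in> A \<Longrightarrow> v i \<in> B"
    and nonneg: "\<And>i. i \<in> A \<Longrightarrow> 0 \<le> w i" and "sum w A \<le> 1"
  shows "(\<Sum>i\<in>A. w i *\<^sub>R v i) \<in> B"
proof (cases "sum w A = 0")
  case True
  then have "w i = 0" if "i \<in> A" for i
    using assms(1) nonneg that by (simp add: sum_nonneg_eq_0_iff)
  then show ?thesis using \<open>0 \<in> B\<close> by simp
next
  case False
  then have "sum w A > 0"
    using sum_nonneg[of A w] nonneg by fastforce
  then have "(\<Sum>i\<in>A. (w i / sum w A) *\<^sub>R v i) \<in> B"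
    using assms nonneg by (intro convex_sum) (auto simp flip: sum_divide_distrib)
  then have "(1 - sum w A) *\<^sub>R 0 + sum w A *\<^sub>R (\<Sum>i\<in>A. (w i / sum w A) *\<^sub>R v i) \<in> B"
    using assms \<open>sum w A > 0\<close> by (intro convexD_alt) auto
  then show ?thesis
    using False by (simp add: scaleR_sum_right)
qed

lemma steinitz_set_sum_mem:
  fixes v :: "'b \<Rightarrow> 'a::euclidean_space"
  assumes A: "finite A" and "steinitz_set v A" and B: "convex B" "0 \<in> B"
    and v: "\<And>i. i \<in> A \<Longrightarrow> v i \<in> B"
  shows "sum v A \<in> (*\<^sub>R) DIM('a) ` B"
proof -
  obtain \<alpha> where \<alpha>: "fractional_zero_sum v A \<alpha>" "real (card A) \<le> sum \<alpha> A + DIM('a)"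
    using assms(2) by (auto simp: steinitz_set_def)
  define w where "w i = (1 - \<alpha> i) / DIM('a)" for i
  have "sum w A \<le> 1"
    using \<alpha>(2) by (simp add: w_def sum_subtractf flip: sum_divide_distrib)
  moreover have "0 \<le> w i" if "i \<in> A" for i
    using \<alpha>(1) that by (simp add: w_def fractional_zero_sum_def)
  ultimately have "(\<Sum>i\<in>A. w i *\<^sub>R v i) \<in> B"
    using A B v by (intro convex_sum_le_1)
  moreover have "sum v A = (\<Sum>i\<in>A. (1 - \<alpha> i) *\<^sub>R v i)"
    using \<alpha>(1) by (simp add: fractional_zero_sum_def scaleR_left_diff_distrib sum_subtractf)
  then have "sum v A = real DIM('a) *\<^sub>R (\<Sum>i\<in>A. w i *\<^sub>R v i)"
    by (simp add: w_def scaleR_sum_right)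
  ultimately show ?thesis by blast
qed

lemma steinitz_set_enumeration:
  assumes "finite I" and "steinitz_set v I"
  obtains xs where "distinct xs" and "set xs = I" and "\<And>k. steinitz_set v (set (take k xs))"
proof -
  have "\<exists>xs. distinct xs \<and> set xs = I \<and> (\<forall>k. steinitz_set v (set (take k xs)))"
    using assms
  proof (induction I rule: finite_remove_induct)
    case empty
    then show ?case by (intro exI[of _ "[]"]) simp
  next
    case (remove A)
    then obtain a where a: "a \<in> A" "steinitz_set v (A - {a})"
      using steinitz_set_remove by metis
    then obtain xs where xs: "distinct xs" "set xs = A - {a}"
        "\<And>k. steinitz_set v (set (take k xs))"
      using remove.IH by blast
    have "steinitz_set v (set (take k (xs @ [a])))" for k
    proof (cases "k \<le> length xs")
      case True
      then show ?thesis using xs(3) by simp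
    next
      case False
      then have "set (take k (xs @ [a])) = A"
        using xs(2) a(1) by auto
      then show ?thesis using remove.prems by simp
    qed
    then show ?case
      using xs a(1) by (intro exI[of _ "xs @ [a]"]) auto
  qed
  then show ?thesis using that by blast
qed

theorem steinitz_rearrangement:
  fixes v :: "'b \<Rightarrow> 'a::euclidean_space"
  assumes I: "finite I" and B: "convex B" "0 \<in> B" and v: "\<And>i. i \<in> I \<Longrightarrow> v i \<in> B"
    and "sum v I = 0"
  obtains xs where "distinct xs" and "set xs = I"
    and "\<And>k. sum v (set (take k xs)) \<in> (*\<^sub>R) DIM('a) ` B"
proof -
  obtain xs where xs: "distinct xs" "set xs = I" "\<And>k. steinitz_set v (set (take k xs))"
    using steinitz_set_enumeration[OF I steinitz_set_if_sum_eq_0] assms(5) by metis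
  have "sum v (set (take k xs)) \<in> (*\<^sub>R) DIM('a) ` B" for k
    using xs(2,3) B v by (intro steinitz_set_sum_mem) (auto dest: in_set_takeD)
  then show ?thesis
    using that xs by blast
qed

section \<open>Boxes of integer vectors\<close>

lemma int_box_iff: "v \<in> int_box r \<longleftrightarrow> (\<forall>j. \<bar>v $ j\<bar> \<le> int r)"
  by (auto simp: int_box_def abs_le_iff minus_le_iff)

lemma int_box_mono: "r \<le> s \<Longrightarrow> int_box r \<subseteq> int_box s"
  unfolding int_box_iff subset_iff by (meson of_nat_le_iff order_trans)

lemma uminus_mem_int_box_iff [simp]: "- v \<in> int_box r \<longleftrightarrow> v \<in> int_box r"
  by (simp add: int_box_iff)

lemma bij_betw_vec_nth_int_box:
  "bij_betw vec_nth (int_box r :: (int ^ 'd) set) (UNIV \<rightarrow>\<^sub>E {- int r..int r})"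
  by (intro bij_betwI[of _ _ _ vec_lambda]) (auto simp: int_box_def PiE_def Pi_def)

lemma finite_int_box: "finite (int_box r :: (int ^ 'd) set)"
  by (simp add: bij_betw_finite[OF bij_betw_vec_nth_int_box] finite_PiE)

lemma card_int_box: "card (int_box r :: (int ^ 'd) set) = (2 * r + 1) ^ CARD('d)"
proof -
  have "nat (int r + 1 + int r) = 2 * r + 1" by simp
  then show ?thesis
    by (simp add: bij_betw_same_card[OF bij_betw_vec_nth_int_box] card_PiE)
qed

lemma int_box_sum_decomposition:
  fixes s :: "int ^ 'd"
  assumes "s \<in> int_box (m * r)"
  obtains y :: "nat \<Rightarrow> int ^ 'd" where "\<And>j. j < m \<Longrightarrow> y j \<in> int_box r" and "(\<Sum>j<m. y j) = s"
proof -
  have "\<exists>y :: nat \<Rightarrow> int ^ 'd. (\<forall>j<m. y j \<in> int_box r) \<and> (\<Sum>j<m. y j) = s"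
    using assms
  proof (induction m arbitrary: s)
    case 0
    then show ?case by (simp add: int_box_iff vec_eq_iff)
  next
    case (Suc m)
    define clip :: "int ^ 'd" where "clip = (\<chi> i. max (- int r) (min (int r) (s $ i)))"
    have clip: "clip \<in> int_box r"
      by (auto simp: clip_def int_box_def)
    have "\<bar>(s - clip) $ i\<bar> \<le> int (m * r)" for i
    proof -
      have "\<bar>s $ i\<bar> \<le> int (m * r) + int r"
        using Suc.prems by (simp add: int_box_iff add.commute)
      then show ?thesis by (simp add: clip_def del: of_nat_mult; linarith)
    qed
    then obtain y where y: "\<forall>j<m. y j \<in> int_box r" "(\<Sum>j<m. y j) = s - clip"
      using Suc.IH[of "s - clip"] by (auto simp: int_box_iff)
    have "\<forall>j<Suc m. (y(m := clip)) j \<in> int_box r"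
      using y(1) clip by (simp add: less_Suc_eq)
    moreover have "(\<Sum>j<Suc m. (y(m := clip)) j) = s"
      using y(2) by simp
    ultimately show ?case by blast
  qed
  then show ?thesis using that by blast
qed

definition real_vec :: "int ^ 'd \<Rightarrow> real ^ 'd" where
  "real_vec v = (\<chi> j. of_int (v $ j))"

lemma real_vec_sum: "real_vec (sum z J) = (\<Sum>i\<in>J. real_vec (z i))"
  by (simp add: real_vec_def vec_eq_iff)

lemma real_vec_mem_cbox_iff:
  "real_vec v \<in> cbox (vec (- real r)) (vec (real r)) \<longleftrightarrow> v \<in> int_box r"
proof -
  have "- real r \<le> of_int k \<and> of_int k \<le> real r \<longleftrightarrow> - int r \<le> k \<and> k \<le> int r" for k
    by linarith
  then show ?thesis
    by (simp add: real_vec_def mem_box_cart int_box_def)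
qed

lemma steinitz_rearrangement_int_box:
  fixes z :: "'b \<Rightarrow> int ^ 'd"
  assumes I: "finite I" and z: "\<And>i. i \<in> I \<Longrightarrow> z i \<in> int_box r" and "sum z I = 0"
  obtains xs where "distinct xs" and "set xs = I"
    and "\<And>k. sum z (set (take k xs)) \<in> int_box (r * CARD('d))"
proof -
  let ?B = "cbox (vec (- real r)) (vec (real r)) :: (real ^ 'd) set"
  have "real_vec (0 :: int ^ 'd) = 0"
    by (simp add: real_vec_def vec_eq_iff)
  then have "(\<Sum>i\<in>I. real_vec (z i)) = 0"
    using assms(3) by (metis real_vec_sum)
  moreover have "0 \<in> ?B"
    by (simp add: mem_box_cart)
  ultimately obtain xs where xs: "distinct xs" "set xs = I"
      "\<And>k. (\<Sum>i\<in>set (take k xs). real_vec (z i)) \<in> (*\<^sub>R) DIM(real ^ 'd) ` ?B"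
    using steinitz_rearrangement[OF I, of ?B "\<lambda>i. real_vec (z i)"] z real_vec_mem_cbox_iff
      convex_box(1) by metis
  have "real CARD('d) *\<^sub>R vec a = (vec (a * CARD('d)) :: real ^ 'd)" for a :: real
    by (simp add: vec_eq_iff)
  then have scaled: "(*\<^sub>R) DIM(real ^ 'd) ` ?B
      \<subseteq> cbox (vec (- real (r * CARD('d)))) (vec (real (r * CARD('d))))"
    by (simp add: image_smult_cbox)
  have "sum z (set (take k xs)) \<in> int_box (r * CARD('d))" for k
    using subsetD[OF scaled xs(3)[of k]] by (simp only: real_vec_mem_cbox_iff flip: real_vec_sum)
  then show ?thesis
    using that xs by blast
qed

section \<open>Zero-sum subfamilies\<close>

lemma zero_sum_block:
  fixes z :: "'b \<Rightarrow> 'a::ab_group_add"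
  assumes xs: "distinct xs" and S: "finite S" "\<And>k. sum z (set (take k xs)) \<in> S"
    and D: "D \<subseteq> set xs" and long: "(card D + 1) * card S \<le> length xs"
  obtains K where "K \<noteq> {}" and "K \<subseteq> set xs - D" and "sum z K = 0"
proof -
  define P where "P k = set (take k xs)" for k
  define h where "h k = (sum z (P k), card (P k \<inter> D))" for k
  have "finite D"
    using D finite_subset by blast
  then have "h ` {..length xs} \<subseteq> S \<times> {..card D}"
    using S by (auto simp: h_def P_def intro: card_mono)
  then have "card (h ` {..length xs}) \<le> card (S \<times> {..card D})"
    using S(1) by (intro card_mono) auto
  also have "\<dots> < card {..length xs}"
    using long by (simp add: card_cartesian_product mult.commute)
  finally have "\<not> inj_on h {..length xs}"
    by (rule pigeonhole)
  then obtain k l where kl: "k < l" "l \<le> length xs" "h k = h l"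
    unfolding inj_on_def by (metis atMost_iff linorder_neqE_nat)
  have sub: "P k \<subseteq> P l"
    using kl(1) by (simp add: P_def set_take_subset_set_take)
  have "card (P i) = i" if "i \<le> length xs" for i
    using that xs by (simp add: P_def distinct_card)
  then have "P k \<noteq> P l"
    using kl(1,2) by (metis less_imp_le nat_neq_iff order.trans)
  moreover have "P k \<inter> D = P l \<inter> D"
    using kl(3) sub by (intro card_subset_eq) (auto simp: h_def P_def)
  moreover have "sum z (P l - P k) = 0"
    using kl(3) sub by (simp add: sum_diff h_def P_def)
  ultimately show ?thesis
    using sub by (intro that[of "P l - P k"]) (auto simp: P_def dest: in_set_takeD)
qed

lemma zero_sum_subset_avoiding:
  fixes z :: "'b \<Rightarrow> int ^ 'd"
  assumes I: "finite I" and z: "\<And>i. i \<in> I \<Longrightarrow> z i \<in> int_box r" "sum z I = 0"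
    and D: "D \<subseteq> I" and large: "(card D + 1) * (2 * r * CARD('d) + 1) ^ CARD('d) \<le> card I"
  obtains K where "K \<noteq> {}" and "K \<subseteq> I - D" and "sum z K = 0"
proof -
  obtain xs where xs: "distinct xs" "set xs = I"
      "\<And>k. sum z (set (take k xs)) \<in> int_box (r * CARD('d))"
    using steinitz_rearrangement_int_box[OF I z] by metis
  have "(card D + 1) * card (int_box (r * CARD('d)) :: (int ^ 'd) set) \<le> length xs"
    using large xs(1,2) distinct_card[of xs] by (simp add: card_int_box mult.assoc)
  then show ?thesis
    using zero_sum_block[OF xs(1) finite_int_box xs(3)] D xs(2) that by metis
qed

lemma zero_sum_subset:
  fixes x :: "'b \<Rightarrow> int ^ 'd"
  assumes J: "finite J" and x: "\<And>i. i \<in> J \<Longrightarrow> x i \<in> int_box r" "sum x J \<in> int_box (m * r)"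
    and large: "(m + 1) * (2 * r * CARD('d) + 1) ^ CARD('d) \<le> card J + m"
  obtains K where "K \<noteq> {}" and "K \<subseteq> J" and "sum x K = 0"
proof -
  obtain y where y: "\<And>j. j < m \<Longrightarrow> y j \<in> int_box r" "(\<Sum>j<m. y j) = sum x J"
    using int_box_sum_decomposition[OF x(2)] by blast
  define z where "z = case_sum x (\<lambda>j. - y j)"
  define D :: "('b + nat) set" where "D = Inr ` {..<m}"
  have "z i \<in> int_box r" if "i \<in> J <+> {..<m}" for i
    using that x(1) y(1) by (auto simp: z_def)
  moreover have "sum z (J <+> {..<m}) = 0"
    using J y(2) by (simp add: sum.Plus z_def sum_negf)
  moreover have "card D = m"
    by (simp add: D_def card_image)
  moreover have "card (J <+> {..<m}) = card J + m"
    using J by (simp add: card_Plus)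
  ultimately obtain K where K: "K \<noteq> {}" "K \<subseteq> (J <+> {..<m}) - D" "sum z K = 0"
    using zero_sum_subset_avoiding[of "J <+> {..<m}" z r D] J large by (auto simp: D_def)
  then have "K \<subseteq> Inl ` J"
    by (auto simp: D_def)
  then obtain K' where K': "K' \<subseteq> J" "K = Inl ` K'"
    by (auto simp: subset_image_iff)
  have "sum x K' = sum z K"
    by (simp add: K'(2) sum.reindex z_def)
  then show ?thesis
    using K K' by (intro that[of K']) auto
qed

lemma proper_zero_sum_subset:
  fixes x :: "'b \<Rightarrow> int ^ 'd"
  assumes J: "finite J" and x: "\<And>i. i \<in> J \<Longrightarrow> x i \<in> int_box r" "sum x J \<in> int_box (m * r)"
    and "m \<ge> 1" and large: "(m + 1) * (2 * r * CARD('d) + 1) ^ CARD('d) \<le> card J"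
  obtains K where "K \<noteq> {}" and "K \<subset> J" and "sum x K = 0"
proof (cases "sum x J = 0")
  case False
  obtain K where "K \<noteq> {}" "K \<subseteq> J" "sum x K = 0"
    using zero_sum_subset[OF J x] large by (metis trans_le_add1)
  then show ?thesis
    using False that by blast
next
  case True
  let ?P = "(2 * r * CARD('d) + 1) ^ CARD('d)"
  have "2 * ?P \<le> (m + 1) * ?P"
    using \<open>m \<ge> 1\<close> by (intro mult_le_mono1) simp
  then have J_large: "2 * ?P \<le> card J"
    using large by (rule order_trans)
  moreover have "?P > 0" by simp
  ultimately have "card J > 0" by linarith
  then obtain a where a: "a \<in> J"
    by (auto simp: card_gt_0_iff)
  have "sum x (J - {a}) = - x a"
    using True a J by (simp add: sum_diff1)
  then have "sum x (J - {a}) \<in> int_box (1 * r)"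
    using x(1) a by simp
  moreover have "(1 + 1) * ?P \<le> card (J - {a}) + 1"
    using J_large a J \<open>card J > 0\<close> by simp
  ultimately obtain K where "K \<noteq> {}" "K \<subseteq> J - {a}" "sum x K = 0"
    using zero_sum_subset[of "J - {a}" x r 1] J x(1) by blast
  then show ?thesis
    using a that by blast
qed

lemma le_nat_ceiling_divide_mult:
  fixes q r :: nat
  assumes "r > 0"
  shows "q \<le> nat \<lceil>real q / real r\<rceil> * r"
proof -
  have "real q \<le> real (nat \<lceil>real q / real r\<rceil>) * real r"
    using real_nat_ceiling_ge[of "real q / real r"] assms
    by (simp only: pos_divide_le_eq of_nat_0_less_iff)
  then show ?thesis
    by (simp only: of_nat_le_iff flip: of_nat_mult)
qed

theorem theorem1p3:
  fixes r q n :: nat and x :: "nat \<Rightarrow> int ^ 'd"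
  assumes "r \<ge> 1" and "q \<ge> 1"
    and "int n \<ge> (\<lceil>real q / real r\<rceil> + 2) * (2 * int r * int CARD('d) + 1) ^ CARD('d)"
    and "\<And>i. i < n \<Longrightarrow> x i \<in> int_box r"
    and "(\<Sum>i<n. x i) \<in> int_box q"
  shows "\<exists>I. I \<noteq> {} \<and> I \<subset> {..<n} \<and> (\<Sum>i\<in>I. x i) = 0"
proof -
  define m where "m = nat \<lceil>real q / real r\<rceil>"
  have "real q / real r > 0" using assms(1,2) by simp
  then have m: "m \<ge> 1" "int m = \<lceil>real q / real r\<rceil>" by (auto simp: m_def le_nat_iff)
  have "q \<le> m * r"
    using assms(1) by (simp add: m_def le_nat_ceiling_divide_mult)
  then have "(\<Sum>i<n. x i) \<in> int_box (m * r)"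
    using assms(5) int_box_mono by blast
  moreover have "int ((m + 2) * (2 * r * CARD('d) + 1) ^ CARD('d)) \<le> int n"
    using assms(3) by (simp add: m(2) algebra_simps)
  then have "(m + 1) * (2 * r * CARD('d) + 1) ^ CARD('d) \<le> card {..<n}"
    by (simp only: of_nat_le_iff) simp
  ultimately obtain I where "I \<noteq> {}" "I \<subset> {..<n}" "(\<Sum>i\<in>I. x i) = 0"
    using proper_zero_sum_subset[of "{..<n}" x r m] assms(4) m(1) by auto
  then show ?thesis by blast
qed

end
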